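(* Let $I$ be a monomial ideal in a polynomial ring $R$ over a field and let $>_I$ be a total ordering on $\mathcal G(I)$. If $I$ is bridge-friendly with respect to $>_I$, then the corresponding Barile-Macchia resolution of $R/I$ (the one induced by $>_I$) is minimal.
   Context: Let $R=\Bbbk[x_1,\dots,x_N]$ be a polynomial ring over a field, $I\subseteq R$ a monomial ideal, $\mathcal G(I)$ its set of minimal monomial generators, and $>_I$ a total ordering on $\mathcal G(I)$. For $\sigma\subseteq\mathcal G(I)$, $\operatorname{lcm}(\sigma)$ is the least common multiple of the elements of $\sigma$. Matchings. Let $G=(V,E)$ be the directed graph whose vertices are all subsets of $\mathcal G(I)$ and whose directed edges are the pairs $(\sigma,\sigma')$ with $\sigma'\subseteq\sigma$, $|\sigma'|=|\sigma|-1$. For $A\subseteq E$ let $G^A$ be obtained from $G$ by reversing the edges in $A$. $A$ is an $\operatorname{lcm}$-homogeneous acyclic matching if every subset of $\mathcal G(I)$ appears in at most one edge of $A$, $G^A$ has no directed cycle, and $\operatorname{lcm}(\sigma)=\operatorname{lcm}(\sigma')$ for all $(\sigma,\sigma')\in A$. Subsets not appearing in any edge of $A$ are called ($A$-)critical. Morse resolution. Let $[\sigma:\sigma']=\pm1$ be the coefficient of $\sigma'$ in the simplicial boundary of $\sigma$ (the full simplex on $\mathcal G(I)$, vertices ordered by $>_I$). For an edge $(\sigma,\sigma')$ of $G^A$ put $m(\sigma,\sigma')=-[\sigma':\sigma]$ if $(\sigma',\sigma)\in A$ and $m(\sigma,\sigma')=[\sigma:\sigma']$ otherwise. A gradient path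 $\mathcal P$ is a directed path $\sigma_1\to\cdots\to\sigma_t$ in $G^A$, and $m(\mathcal P)=\prod_i m(\sigma_i,\sigma_{i+1})$. An $\operatorname{lcm}$-homogeneous acyclic matching $A$ induces a free resolution $\mathcal F_A$ of $R/I$ (Batzies–Welker), where $(\mathcal F_A)_r$ is free on the critical subsets of cardinality $r$ and $$\partial_r^A(\sigma)=\sum_{\sigma'\subseteq\sigma,\,|\sigma'|=r-1}[\sigma:\sigma']\sum_{\sigma''\text{ critical},\,|\sigma''|=r-1}\ \sum_{\mathcal P\text{ gradient path from }\sigma'\text{ to }\sigma''} m(\mathcal P)\frac{\operatorname{lcm}(\sigma)}{\operatorname{lcm}(\sigma'')}\sigma''.$$ Bridges and the algorithm. $m\in\mathcal G(I)$ is a bridge of $\sigma$ if $m\in\sigma$ and $\operatorname{lcm}(\sigma\setminus m)=\operatorname{lcm}(\sigma)$. $\operatorname{sb}(\sigma)$ is the $>_I$-smallest bridge of $\sigma$ if one exists, and $\emptyset$ otherwise ($\sigma\setminus\emptyset=\sigma$). Barile-Macchia algorithm: start with $A=\emptyset$, $\Omega=\{\sigma\subseteq\mathcal G(I):|\sigma|\ge3\}$. (1) Pick $\sigma\in\Omega$ of maximal cardinality. (2) Replace $\Omega$ by $\Omega\setminus\{\sigma,\sigma\setminus\operatorname{sb}(\sigma)\}$; if $\operatorname{sb}(\sigma)\neq\emptyset$ add the edge $(\sigma,\sigma\setminus\operatorname{sb}(\sigma))$ to $A$; if $\Omega\ne\emptyset$ return to (1). (3) Whenever two distinct edges $(\sigma,\sigma\setminus\operatorname{sb}(\sigma))$,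 $(\sigma',\sigma'\setminus\operatorname{sb}(\sigma'))$ of $A$ have the same target, remove the one whose smallest bridge is larger with respect to $>_I$. The output $A$ is an $\operatorname{lcm}$-homogeneous acyclic matching, called the Barile-Macchia matching, and $\mathcal F_A$ is the Barile-Macchia resolution (induced by $>_I$). Types. A subset $\sigma$ is potentially-type-2 if the edge $(\sigma,\sigma\setminus\operatorname{sb}(\sigma))$ is added to $A$ in step (2); it is type-2 if this edge remains in the final $A$. $I$ is bridge-friendly with respect to $>_I$ if all potentially-type-2 subsets are type-2.
   Formalization: The ideal I is assumed proper (I ≠ R); for I = R one has G(I) = {1}, bridge-friendliness is vacuous, and the induced resolution 0 → R → R → 0 has an isomorphism as differential, so it is not minimal. *)

theory Defs
  imports Complex_Main "HOL-Library.Poly_Mapping"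
begin

section \<open>Monomial ideals in a polynomial ring\<close>

text \<open>The polynomial ring over \<open>'k\<close> whose variables are the elements of the finite type \<open>'x\<close>.
  A monomial is represented by its exponent vector.\<close>

type_synonym 'x mon = "'x \<Rightarrow>\<^sub>0 nat"
type_synonym ('x, 'k) mpoly = "'x mon \<Rightarrow>\<^sub>0 'k"

definition monom :: "'x mon \<Rightarrow> ('x, 'k::field) mpoly" where
  "monom m = Poly_Mapping.single m 1"

definition ideal_gen :: "'r::comm_ring_1 set \<Rightarrow> 'r set" where
  "ideal_gen B = module.span (*) B"

definition monomial_ideal :: "('x, 'k::field) mpoly set \<Rightarrow> bool" where
  "monomial_ideal I \<longleftrightarrow> (\<exists>S. I = ideal_gen (monom ` S))"

definition max_ideal :: "('x, 'k::field) mpoly set" where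
  "max_ideal = ideal_gen (range (\<lambda>x. monom (Poly_Mapping.single x 1)))"

text \<open>The monomials of \<open>I\<close> that are minimal with respect to divisibility; by
  \<open>mingens_iff\<close> below this is the only set of monomials that generates \<open>I\<close> and has no
  proper subset generating \<open>I\<close>.\<close>

definition mingens :: "('x, 'k::field) mpoly set \<Rightarrow> 'x mon set" where
  "mingens I = {m. monom m \<in> I \<and>
     (\<forall>m'. monom m' \<in> I \<and> (monom m' :: ('x, 'k) mpoly) dvd monom m \<longrightarrow> m' = m)}"

text \<open>Exponent vector of the least common multiple; the \<open>insert 0\<close> only matters for
  \<open>lcm \<emptyset> = 1\<close>.\<close>

definition lcm_mon :: "'x::finite mon set \<Rightarrow> 'x mon" where
  "lcm_mon \<sigma> = Abs_poly_mapping (\<lambda>x. Max (insert 0 ((\<lambda>m. Poly_Mapping.lookup m x) ` \<sigma>)))"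


section \<open>The Barile-Macchia algorithm\<close>

text \<open>Throughout, \<open>G\<close> is the set of minimal generators and \<open>(m, m') \<in> gt\<close> means that
  \<open>m\<close> is larger than \<open>m'\<close>.\<close>

definition bridge :: "'x::finite mon set \<Rightarrow> 'x mon \<Rightarrow> bool" where
  "bridge \<sigma> m \<longleftrightarrow> m \<in> \<sigma> \<and> lcm_mon (\<sigma> - {m}) = lcm_mon \<sigma>"

text \<open>The smallest bridge as a set: a singleton, or empty if there is no bridge.\<close>

definition sb :: "('x::finite mon \<times> 'x mon) set \<Rightarrow> 'x mon set \<Rightarrow> 'x mon set" where
  "sb gt \<sigma> = {m. bridge \<sigma> m \<and> (\<forall>m'. bridge \<sigma> m' \<and> m' \<noteq> m \<longrightarrow> (m', m) \<in> gt)}"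

type_synonym 'x edges = "('x mon set \<times> 'x mon set) set"

text \<open>Reachable states \<open>(\<Omega>, A)\<close> of the loop formed by steps (1) and (2).\<close>

inductive bm_state ::
  "'x::finite mon set \<Rightarrow> ('x mon \<times> 'x mon) set \<Rightarrow> 'x mon set set \<Rightarrow> 'x edges \<Rightarrow> bool"
  for G gt where
  start: "bm_state G gt {\<sigma>. \<sigma> \<subseteq> G \<and> 3 \<le> card \<sigma>} {}"
| step: "bm_state G gt \<Omega> A \<Longrightarrow> \<sigma> \<in> \<Omega> \<Longrightarrow> (\<forall>\<tau>\<in>\<Omega>. card \<tau> \<le> card \<sigma>) \<Longrightarrow>
    bm_state G gt (\<Omega> - {\<sigma>, \<sigma> - sb gt \<sigma>})
      (if sb gt \<sigma> = {} then A else insert (\<sigma>, \<sigma> - sb gt \<sigma>) A)"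

text \<open>The edge set when the loop has terminated. It does not depend on the choices made in
  step (1): see \<open>bm_state_final_ex1\<close>.\<close>

definition bm_loop_edges :: "'x::finite mon set \<Rightarrow> ('x mon \<times> 'x mon) set \<Rightarrow> 'x edges" where
  "bm_loop_edges G gt = (THE A. bm_state G gt {} A)"

text \<open>Step (3).\<close>

definition bm_matching :: "'x::finite mon set \<Rightarrow> ('x mon \<times> 'x mon) set \<Rightarrow> 'x edges" where
  "bm_matching G gt = {(\<sigma>, \<tau>) \<in> bm_loop_edges G gt.
     \<not> (\<exists>\<sigma>'. \<sigma>' \<noteq> \<sigma> \<and> (\<sigma>', \<tau>) \<in> bm_loop_edges G gt \<and>
          (\<exists>m\<in>sb gt \<sigma>. \<exists>m'\<in>sb gt \<sigma>'. (m, m') \<in> gt))}"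

definition potentially_type2 ::
  "'x::finite mon set \<Rightarrow> ('x mon \<times> 'x mon) set \<Rightarrow> 'x mon set \<Rightarrow> bool" where
  "potentially_type2 G gt \<sigma> \<longleftrightarrow> (\<sigma>, \<sigma> - sb gt \<sigma>) \<in> bm_loop_edges G gt"

definition type2 ::
  "'x::finite mon set \<Rightarrow> ('x mon \<times> 'x mon) set \<Rightarrow> 'x mon set \<Rightarrow> bool" where
  "type2 G gt \<sigma> \<longleftrightarrow> (\<sigma>, \<sigma> - sb gt \<sigma>) \<in> bm_matching G gt"

definition bridge_friendly ::
  "('x::finite, 'k::field) mpoly set \<Rightarrow> ('x mon \<times> 'x mon) set \<Rightarrow> bool" where
  "bridge_friendly I gt \<longleftrightarrow>
     (\<forall>\<sigma> \<subseteq> mingens I. potentially_type2 (mingens I) gt \<sigma> \<longrightarrow> type2 (mingens I) gt \<sigma>)"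


section \<open>The Morse resolution of a matching\<close>

definition subset_edges :: "'x mon set \<Rightarrow> 'x edges" where
  "subset_edges G = {(\<sigma>, \<sigma>'). \<sigma> \<subseteq> G \<and> \<sigma>' \<subseteq> \<sigma> \<and> card \<sigma> = Suc (card \<sigma>')}"

definition reversed_edges :: "'x mon set \<Rightarrow> 'x edges \<Rightarrow> 'x edges" where
  "reversed_edges G A = (subset_edges G - A) \<union> A\<inverse>"

definition critical :: "'x mon set \<Rightarrow> 'x edges \<Rightarrow> 'x mon set set" where
  "critical G A = {\<sigma>. \<sigma> \<subseteq> G \<and> (\<forall>e\<in>A. \<sigma> \<noteq> fst e \<and> \<sigma> \<noteq> snd e)}"

text \<open>The coefficient of the facet \<open>\<sigma>'\<close> in the boundary of the simplex \<open>\<sigma>\<close>, whose vertices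
  are listed from the largest to the smallest: the exponent is the position, counted from 0, of
  the vertex that is left out.\<close>

definition incidence :: "('x mon \<times> 'x mon) set \<Rightarrow> 'x mon set \<Rightarrow> 'x mon set \<Rightarrow> int" where
  "incidence gt \<sigma> \<sigma>' = (- 1) ^ card {m \<in> \<sigma>. \<exists>v \<in> \<sigma> - \<sigma>'. (m, v) \<in> gt}"

definition edge_weight ::
  "('x mon \<times> 'x mon) set \<Rightarrow> 'x edges \<Rightarrow> 'x mon set \<Rightarrow> 'x mon set \<Rightarrow> int" where
  "edge_weight gt A \<sigma> \<sigma>' =
     (if (\<sigma>', \<sigma>) \<in> A then - incidence gt \<sigma>' \<sigma> else incidence gt \<sigma> \<sigma>')"

text \<open>Directed paths as vertex lists; the one-vertex path is allowed. Vertices are required to be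
  distinct, which is automatic for an acyclic matching and keeps the set of paths finite.\<close>

definition gradient_paths ::
  "'x mon set \<Rightarrow> 'x edges \<Rightarrow> 'x mon set \<Rightarrow> 'x mon set \<Rightarrow> 'x mon set list set" where
  "gradient_paths G A \<sigma> \<tau> = {P. P \<noteq> [] \<and> hd P = \<sigma> \<and> last P = \<tau> \<and> set P \<subseteq> Pow G \<and> distinct P \<and>
     successively (\<lambda>\<rho> \<rho>'. (\<rho>, \<rho>') \<in> reversed_edges G A) P}"

definition path_weight :: "('x mon \<times> 'x mon) set \<Rightarrow> 'x edges \<Rightarrow> 'x mon set list \<Rightarrow> int" where
  "path_weight gt A P = (\<Prod>i<length P - 1. edge_weight gt A (P ! i) (P ! Suc i))"

text \<open>An element of the free module with basis \<open>B\<close> is a finitely supported function on \<open>B\<close>.\<close>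

definition free_module :: "'b set \<Rightarrow> ('b \<Rightarrow>\<^sub>0 'r::comm_ring_1) set" where
  "free_module B = {f. Poly_Mapping.keys f \<subseteq> B}"

definition smult :: "'r::comm_ring_1 \<Rightarrow> ('b \<Rightarrow>\<^sub>0 'r) \<Rightarrow> ('b \<Rightarrow>\<^sub>0 'r)" where
  "smult a f = Poly_Mapping.map ((*) a) f"

definition morse_module ::
  "'x mon set \<Rightarrow> 'x edges \<Rightarrow> nat \<Rightarrow> ('x mon set \<Rightarrow>\<^sub>0 ('x, 'k::field) mpoly) set" where
  "morse_module G A r = free_module {\<sigma> \<in> critical G A. card \<sigma> = r}"

text \<open>Image of the basis element \<open>\<sigma>\<close>. The truncated subtraction of exponents is the exact quotient
  of monomials, since \<open>lcm\<close> can only decrease along gradient paths of an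
  \<open>lcm\<close>-homogeneous matching.\<close>

definition morse_diff_basis ::
  "'x::finite mon set \<Rightarrow> ('x mon \<times> 'x mon) set \<Rightarrow> 'x edges \<Rightarrow> 'x mon set \<Rightarrow>
    ('x mon set \<Rightarrow>\<^sub>0 ('x, 'k::field) mpoly)" where
  "morse_diff_basis G gt A \<sigma> =
     (\<Sum>\<sigma>' | \<sigma>' \<subseteq> \<sigma> \<and> Suc (card \<sigma>') = card \<sigma>.
        smult (of_int (incidence gt \<sigma> \<sigma>'))
          (\<Sum>\<tau> | \<tau> \<in> critical G A \<and> Suc (card \<tau>) = card \<sigma>.
             \<Sum>P\<in>gradient_paths G A \<sigma>' \<tau>.
               Poly_Mapping.single \<tau>
                 (of_int (path_weight gt A P) * monom (lcm_mon \<sigma> - lcm_mon \<tau>))))"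

definition morse_diff ::
  "'x::finite mon set \<Rightarrow> ('x mon \<times> 'x mon) set \<Rightarrow> 'x edges \<Rightarrow>
    ('x mon set \<Rightarrow>\<^sub>0 ('x, 'k::field) mpoly) \<Rightarrow> ('x mon set \<Rightarrow>\<^sub>0 ('x, 'k) mpoly)" where
  "morse_diff G gt A f =
     (\<Sum>\<sigma>\<in>Poly_Mapping.keys f. smult (Poly_Mapping.lookup f \<sigma>) (morse_diff_basis G gt A \<sigma>))"

text \<open>The product \<open>\<aa>F\<close> of an ideal and a submodule.\<close>

definition ideal_times ::
  "'r::comm_ring_1 set \<Rightarrow> ('b \<Rightarrow>\<^sub>0 'r) set \<Rightarrow> ('b \<Rightarrow>\<^sub>0 'r) set" where
  "ideal_times \<aa> F = module.span smult {smult a f | a f. a \<in> \<aa> \<and> f \<in> F}"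

text \<open>Minimality of a free resolution given by its modules \<open>F\<close> and differentials \<open>d r\<close> from
  \<open>F r\<close> to \<open>F (r - 1)\<close>: \<open>d r\<close> maps into the product of the ideal generated by the variables
  with \<open>F (r - 1)\<close>.\<close>

definition minimal_complex ::
  "(nat \<Rightarrow> ('b \<Rightarrow>\<^sub>0 ('x, 'k::field) mpoly) set) \<Rightarrow>
    (nat \<Rightarrow> ('b \<Rightarrow>\<^sub>0 ('x, 'k) mpoly) \<Rightarrow> ('b \<Rightarrow>\<^sub>0 ('x, 'k) mpoly)) \<Rightarrow> bool" where
  "minimal_complex F d \<longleftrightarrow> (\<forall>r\<ge>1. d r ` F r \<subseteq> ideal_times max_ideal (F (r - 1)))"


definition barile_macchia_module ::
  "('x::finite, 'k::field) mpoly set \<Rightarrow> ('x mon \<times> 'x mon) set \<Rightarrow> nat \<Rightarrow>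
    ('x mon set \<Rightarrow>\<^sub>0 ('x, 'k) mpoly) set" where
  "barile_macchia_module I gt r = morse_module (mingens I) (bm_matching (mingens I) gt) r"

text \<open>The formula for the differential is the same in all degrees \<open>r\<close>.\<close>

definition barile_macchia_diff ::
  "('x::finite, 'k::field) mpoly set \<Rightarrow> ('x mon \<times> 'x mon) set \<Rightarrow> nat \<Rightarrow>
    ('x mon set \<Rightarrow>\<^sub>0 ('x, 'k) mpoly) \<Rightarrow> ('x mon set \<Rightarrow>\<^sub>0 ('x, 'k) mpoly)" where
  "barile_macchia_diff I gt r = morse_diff (mingens I) gt (bm_matching (mingens I) gt)"


section \<open>The definitions above are well posed\<close>

lemma module_mult: "module ((*) :: 'r::comm_ring_1 \<Rightarrow> 'r \<Rightarrow> 'r)"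
  by unfold_locales (simp_all add: algebra_simps)

lemmas ideal_span_scale = module.span_scale[OF module_mult]
  and ideal_span_base = module.span_base[OF module_mult]
  and ideal_span_minimal = module.span_minimal[OF module_mult]
  and ideal_subspace_span = module.subspace_span[OF module_mult]

lemma lookup_smult [simp]: "Poly_Mapping.lookup (smult a f) b = a * Poly_Mapping.lookup f b"
  by (simp add: smult_def map.rep_eq when_def)

lemma module_smult: "module (smult :: 'r::comm_ring_1 \<Rightarrow> ('b \<Rightarrow>\<^sub>0 'r) \<Rightarrow> _)"
  by unfold_locales (auto intro!: poly_mapping_eqI simp: lookup_add algebra_simps)

lemma lookup_lcm_mon:
  "Poly_Mapping.lookup (lcm_mon \<sigma>) x = Max (insert 0 ((\<lambda>m. Poly_Mapping.lookup m x) ` \<sigma>))"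
  by (simp add: lcm_mon_def)

subsection \<open>Minimal generators\<close>

lemma keys_in_ideal_gen:
  assumes "p \<in> ideal_gen (monom ` S)" "k \<in> Poly_Mapping.keys (p :: ('x, 'k::field) mpoly)"
  shows "\<exists>s\<in>S. \<exists>t. k = s + t"
proof -
  have "p \<in> module.span (*) (monom ` S)" using assms(1) by (simp add: ideal_gen_def)
  then have "\<forall>k\<in>Poly_Mapping.keys p. \<exists>s\<in>S. \<exists>t. k = s + t"
  proof (induction rule: module.span_induct_alt[OF module_mult, consumes 1, case_names base step])
    case base
    then show ?case by simp
  next
    case (step c x y)
    from step(1) obtain s where s: "s \<in> S" "x = monom s" by (rule imageE)
    show ?case
    proof
      fix k assume "k \<in> Poly_Mapping.keys (c * x + y)"
      then have "k \<in> Poly_Mapping.keys (c * x) \<or> k \<in> Poly_Mapping.keys y"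
        using keys_add[of "c * x" y] by (auto dest: subsetD)
      then show "\<exists>s\<in>S. \<exists>t. k = s + t"
      proof
        assume "k \<in> Poly_Mapping.keys (c * x)"
        then have "k \<in> {a + b | a b. a \<in> Poly_Mapping.keys c \<and> b \<in> Poly_Mapping.keys x}"
          by (rule subsetD[OF keys_mult])
        then obtain a where "k = a + s" using s(2) by (auto simp: monom_def)
        then show ?thesis using s(1) by (metis add.commute)
      next
        assume "k \<in> Poly_Mapping.keys y"
        then show ?thesis using step by blast
      qed
    qed
  qed
  then show ?thesis using assms(2) by blast
qed

lemma monom_mult: "monom (a + b) = (monom a * monom b :: ('x, 'k::field) mpoly)"
  by (simp add: monom_def mult_single)

lemma keys_monom [simp]: "Poly_Mapping.keys (monom m :: ('x, 'k::field) mpoly) = {m}"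
  by (simp add: monom_def)

lemma monom_dvd_iff:
  "(monom a :: ('x, 'k::field) mpoly) dvd monom b \<longleftrightarrow> (\<exists>t. b = a + t)"
proof
  assume "(monom a :: ('x, 'k) mpoly) dvd monom b"
  then obtain c where c: "(monom b :: ('x, 'k) mpoly) = monom a * c" by (auto elim: dvdE)
  have "b \<in> Poly_Mapping.keys (monom a * c)" unfolding c[symmetric] by simp
  then have "b \<in> {u + v | u v. u \<in> Poly_Mapping.keys (monom a :: ('x, 'k) mpoly) \<and> v \<in> Poly_Mapping.keys c}"
    by (rule subsetD[OF keys_mult])
  then show "\<exists>t. b = a + t" by auto
qed (auto simp: monom_mult)

lemma monom_in_ideal_gen_iff:
  "(monom m :: ('x, 'k::field) mpoly) \<in> ideal_gen (monom ` S) \<longleftrightarrow> (\<exists>s\<in>S. \<exists>t. m = s + t)"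
proof
  assume "(monom m :: ('x, 'k) mpoly) \<in> ideal_gen (monom ` S)"
  then show "\<exists>s\<in>S. \<exists>t. m = s + t" by (rule keys_in_ideal_gen) simp
next
  assume "\<exists>s\<in>S. \<exists>t. m = s + t"
  then obtain s t where s: "s \<in> S" and m: "m = t + s" by (metis add.commute)
  then show "(monom m :: ('x, 'k) mpoly) \<in> ideal_gen (monom ` S)"
    unfolding ideal_gen_def m monom_mult by (intro ideal_span_scale ideal_span_base imageI s)
qed

lemma ideal_gen_mono_iff:
  "ideal_gen (monom ` S) \<subseteq> (ideal_gen (monom ` T) :: ('x, 'k::field) mpoly set) \<longleftrightarrow>
     (\<forall>s\<in>S. \<exists>t\<in>T. \<exists>u. s = t + u)" (is "?l \<longleftrightarrow> ?r")
proof
  show ?r if ?l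
  proof
    fix s assume "s \<in> S"
    with that have "(monom s :: ('x, 'k) mpoly) \<in> ideal_gen (monom ` T)"
      unfolding ideal_gen_def by (metis image_eqI ideal_span_base subsetD)
    then show "\<exists>t\<in>T. \<exists>u. s = t + u" by (simp add: monom_in_ideal_gen_iff)
  qed
  show ?l if ?r
  proof -
    have "monom ` S \<subseteq> (ideal_gen (monom ` T) :: ('x, 'k) mpoly set)"
      using that by (auto simp only: monom_in_ideal_gen_iff)
    then show ?thesis
      unfolding ideal_gen_def by (rule ideal_span_minimal) (rule ideal_subspace_span)
  qed
qed

definition mdeg :: "'x::finite mon \<Rightarrow> nat" where
  "mdeg m = (\<Sum>x\<in>UNIV. Poly_Mapping.lookup m x)"

lemma mdeg_add: "mdeg (a + b) = mdeg a + mdeg b"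
  by (simp add: mdeg_def lookup_add sum.distrib)

lemma mdeg_0_iff: "mdeg a = 0 \<longleftrightarrow> a = 0"
  by (auto simp: mdeg_def poly_mapping_eq_iff fun_eq_iff)

lemma exists_mingen_below:
  assumes "(monom m :: ('x::finite, 'k::field) mpoly) \<in> I"
  shows "\<exists>g\<in>mingens I. \<exists>t. m = g + t"
  using assms
proof (induction "mdeg m" arbitrary: m rule: less_induct)
  case less
  show ?case
  proof (cases "m \<in> mingens I")
    case True
    then show ?thesis by (metis add_0_right)
  next
    case False
    then obtain m' where m': "(monom m' :: ('x, 'k) mpoly) \<in> I" "m' \<noteq> m"
      "(monom m' :: ('x, 'k) mpoly) dvd monom m"
      using less.prems by (auto simp: mingens_def)
    then obtain t where t: "m = m' + t" by (auto simp: monom_dvd_iff)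
    with m' have "t \<noteq> 0" by auto
    then have "mdeg m' < mdeg m" by (simp add: t mdeg_add mdeg_0_iff flip: neq0_conv)
    from less.hyps[OF this m'(1)] obtain g u where "g \<in> mingens I" "m' = g + u" by auto
    then show ?thesis by (metis t add.assoc)
  qed
qed

lemma mingens_antichain:
  assumes "g \<in> mingens (I :: ('x, 'k::field) mpoly set)" "h \<in> mingens I" "h = g + t"
  shows "g = h"
  using assms unfolding mingens_def by (auto simp: monom_dvd_iff)

lemma mingens_generate:
  assumes "monomial_ideal (I :: ('x::finite, 'k::field) mpoly set)"
  shows "ideal_gen (monom ` mingens I) = I"
proof -
  obtain S where I: "I = ideal_gen (monom ` S)" using assms by (auto simp: monomial_ideal_def)
  have "s \<in> S \<Longrightarrow> monom s \<in> I" for s unfolding I ideal_gen_def by (auto intro: ideal_span_base)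
  then have "I \<subseteq> ideal_gen (monom ` mingens I)"
    by (subst (1) I, unfold ideal_gen_mono_iff) (blast intro: exists_mingen_below)
  moreover have "monom ` mingens I \<subseteq> I" by (auto simp: mingens_def)
  then have "ideal_gen (monom ` mingens I) \<subseteq> I"
    unfolding ideal_gen_def by (metis I ideal_gen_def ideal_span_minimal ideal_subspace_span)
  ultimately show ?thesis by blast
qed

theorem mingens_iff:
  assumes "monomial_ideal (I :: ('x::finite, 'k::field) mpoly set)"
  shows "M = mingens I \<longleftrightarrow>
    ideal_gen (monom ` M) = I \<and> (\<forall>M'\<subset>M. ideal_gen (monom ` M') \<noteq> I)"
proof
  have "ideal_gen (monom ` M') \<noteq> I" if M': "M' \<subset> mingens I" for M'
  proof
    assume eq: "ideal_gen (monom ` M') = I"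
    from M' obtain g where g: "g \<in> mingens I" "g \<notin> M'" by blast
    then have "(monom g :: ('x, 'k) mpoly) \<in> ideal_gen (monom ` M')"
      unfolding eq by (simp add: mingens_def)
    then obtain h t where h: "h \<in> M'" "g = h + t" by (auto simp: monom_in_ideal_gen_iff)
    then have "h \<in> mingens I" using M' by blast
    then have "h = g" using g(1) h(2) by (rule mingens_antichain)
    then show False using g h by simp
  qed
  then show "M = mingens I \<Longrightarrow>
      ideal_gen (monom ` M) = I \<and> (\<forall>M'\<subset>M. ideal_gen (monom ` M') \<noteq> I)"
    using mingens_generate[OF assms] by simp
next
  assume M: "ideal_gen (monom ` M) = I \<and> (\<forall>M'\<subset>M. ideal_gen (monom ` M') \<noteq> I)"
  have "mingens I \<subseteq> M"
  proof
    fix g assume g: "g \<in> mingens I"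
    then have "(monom g :: ('x, 'k) mpoly) \<in> ideal_gen (monom ` M)"
      using M by (simp add: mingens_def)
    then obtain h t where h: "h \<in> M" "g = h + t" by (auto simp: monom_in_ideal_gen_iff)
    have "(monom h :: ('x, 'k) mpoly) \<in> ideal_gen (monom ` M)"
      unfolding monom_in_ideal_gen_iff using h(1) by (metis add_0_right)
    then have "(monom h :: ('x, 'k) mpoly) \<in> I" using M by simp
    moreover have "(monom h :: ('x, 'k) mpoly) dvd monom g" using h by (auto simp: monom_dvd_iff)
    ultimately have "h = g" using g by (simp add: mingens_def)
    then show "g \<in> M" using h by simp
  qed
  then show "M = mingens I"
    using M mingens_generate[OF assms] by (metis psubsetI)
qed

lemma nat_mono_subseq:
  fixes s :: "nat \<Rightarrow> nat"
  shows "\<exists>f. strict_mono f \<and> incseq (\<lambda>n. s (f n))"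
proof -
  obtain f where f: "strict_mono f" "monoseq (\<lambda>n. s (f n))" using seq_monosub by blast
  show ?thesis
  proof (cases "incseq (\<lambda>n. s (f n))")
    case False
    with f(2) have dec: "decseq (\<lambda>n. s (f n))" by (auto simp: monoseq_iff)
    define v where "v = (LEAST v. \<exists>n. v = s (f n))"
    obtain N where N: "v = s (f N)" unfolding v_def using LeastI_ex[of "\<lambda>v. \<exists>n. v = s (f n)"] by blast
    have "v \<le> s (f n)" for n unfolding v_def by (rule Least_le) blast
    with dec N have "s (f (N + n)) = v" for n
      by (metis decseqD le_add1 le_antisym)
    then have "incseq (\<lambda>n. s (f (N + n)))" by (simp add: incseq_def)
    moreover have "strict_mono (\<lambda>n. f (N + n))" using f(1) by (simp add: strict_mono_def)
    ultimately show ?thesis by (intro exI[of _ "\<lambda>n. f (N + n)"]) simp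
  qed (use f in blast)
qed

lemma mon_mono_subseq:
  fixes s :: "nat \<Rightarrow> 'x mon"
  assumes "finite X"
  shows "\<exists>f. strict_mono f \<and> (\<forall>x\<in>X. incseq (\<lambda>n. Poly_Mapping.lookup (s (f n)) x))"
  using assms
proof (induction X)
  case empty
  then show ?case by (auto intro: exI[of _ id] simp: strict_mono_def)
next
  case (insert y X)
  then obtain f where f: "strict_mono f" "\<forall>x\<in>X. incseq (\<lambda>n. Poly_Mapping.lookup (s (f n)) x)"
    by blast
  obtain g where g: "strict_mono g" "incseq (\<lambda>n. Poly_Mapping.lookup (s (f (g n))) y)"
    using nat_mono_subseq[of "\<lambda>n. Poly_Mapping.lookup (s (f n)) y"] by blast
  have "incseq (\<lambda>n. Poly_Mapping.lookup (s (f (g n))) x)" if "x \<in> X" for x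
    using f(2) that g(1) by (simp add: incseq_def strict_mono_less_eq)
  with f(1) g show ?case
    by (intro exI[of _ "\<lambda>n. f (g n)"]) (auto simp: strict_mono_def)
qed

lemma finite_mingens: "finite (mingens (I :: ('x::finite, 'k::field) mpoly set))"
proof (rule ccontr)
  assume "infinite (mingens I)"
  then obtain s :: "nat \<Rightarrow> 'x mon" where s: "inj s" "\<And>n. s n \<in> mingens I"
    by (meson infinite_countable_subset range_subsetD)
  obtain f where f: "strict_mono f" "\<And>x. incseq (\<lambda>n. Poly_Mapping.lookup (s (f n)) x)"
    using mon_mono_subseq[of "UNIV :: 'x set" s] by auto
  have "s (f 1) = s (f 0) + (s (f 1) - s (f 0))"
    using f(2) by (intro poly_mapping_eqI) (simp add: lookup_add lookup_minus incseq_def)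
  with s(2) s(2) have "s (f 0) = s (f 1)" by (rule mingens_antichain)
  then show False using s(1) f(1) by (auto dest!: injD simp: strict_mono_eq)
qed

subsection \<open>Termination and confluence of the loop\<close>

lemma sb_cases:
  assumes "strict_linear_order_on G gt"
  obtains "sb gt \<sigma> = {}" | m where "m \<in> \<sigma>" "sb gt \<sigma> = {m}"
proof (cases "sb gt \<sigma> = {}")
  case False
  then obtain m where m: "m \<in> sb gt \<sigma>" by blast
  have "m' = m" if "m' \<in> sb gt \<sigma>" for m'
  proof (rule ccontr)
    assume "m' \<noteq> m"
    then have "(m, m') \<in> gt" "(m', m) \<in> gt" using m that by (auto simp: sb_def)
    then show False using assms by (meson irreflD strict_linear_order_on_def transD)
  qed
  with m have "sb gt \<sigma> = {m}" by blast
  moreover have "m \<in> \<sigma>" using m by (simp add: sb_def bridge_def)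
  ultimately show ?thesis using that by blast
qed (use that in blast)

lemma card_minus_sb:
  assumes "strict_linear_order_on G gt" "finite \<sigma>" "sb gt \<sigma> \<noteq> {}"
  shows "card \<sigma> = Suc (card (\<sigma> - sb gt \<sigma>))"
  using assms(1)
proof (cases rule: sb_cases[where \<sigma> = \<sigma>])
  case (2 m)
  then show ?thesis using card_Suc_Diff1[OF assms(2) 2(1)] by simp
qed (use assms(3) in blast)

lemma bm_state_inv:
  assumes "bm_state G gt \<Omega> A" "finite G" "strict_linear_order_on G gt"
  shows "\<Omega> \<subseteq> {\<sigma>. \<sigma> \<subseteq> G \<and> 3 \<le> card \<sigma>} \<and>
    (\<forall>\<sigma> \<tau>. (\<sigma>, \<tau>) \<in> A \<longrightarrow> \<sigma> \<subseteq> G \<and> 3 \<le> card \<sigma> \<and> sb gt \<sigma> \<noteq> {} \<and> \<tau> = \<sigma> - sb gt \<sigma> \<and> \<sigma> \<notin> \<Omega> \<and> \<tau> \<notin> \<Omega> \<and>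
       (\<forall>\<rho>\<in>\<Omega>. card \<rho> \<le> card \<sigma>) \<and> (\<forall>\<rho>. (\<rho>, \<sigma>) \<notin> A)) \<and>
    (\<forall>\<sigma>. \<sigma> \<subseteq> G \<and> 3 \<le> card \<sigma> \<and> \<sigma> \<notin> \<Omega> \<and> sb gt \<sigma> \<noteq> {} \<longrightarrow>
       (\<sigma>, \<sigma> - sb gt \<sigma>) \<in> A \<or> (\<exists>\<rho>. (\<rho>, \<sigma>) \<in> A))"
  using assms
proof (induction rule: bm_state.induct)
  case start
  then show ?case by blast
next
  case (step \<Omega> A \<sigma>)
  note IH = step.IH[OF step.prems]
  have IH1: "\<Omega> \<subseteq> {\<sigma>. \<sigma> \<subseteq> G \<and> 3 \<le> card \<sigma>}" using IH by (rule conjunct1)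
  have IH2: "\<alpha> \<subseteq> G \<and> 3 \<le> card \<alpha> \<and> sb gt \<alpha> \<noteq> {} \<and> \<tau> = \<alpha> - sb gt \<alpha> \<and> \<alpha> \<notin> \<Omega> \<and> \<tau> \<notin> \<Omega> \<and>
       (\<forall>\<rho>\<in>\<Omega>. card \<rho> \<le> card \<alpha>) \<and> (\<forall>\<rho>. (\<rho>, \<alpha>) \<notin> A)" if "(\<alpha>, \<tau>) \<in> A" for \<alpha> \<tau>
    using IH[THEN conjunct2, THEN conjunct1, rule_format, OF that] by blast
  have IH3: "(\<alpha>, \<alpha> - sb gt \<alpha>) \<in> A \<or> (\<exists>\<rho>. (\<rho>, \<alpha>) \<in> A)"
    if "\<alpha> \<subseteq> G" "3 \<le> card \<alpha>" "\<alpha> \<notin> \<Omega>" "sb gt \<alpha> \<noteq> {}" for \<alpha>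
    using IH[THEN conjunct2, THEN conjunct2, rule_format, of \<alpha>] that by blast
  have fin: "finite \<rho>" if "\<rho> \<subseteq> G" for \<rho> using that step.prems(1) finite_subset by blast
  have \<sigma>: "\<sigma> \<subseteq> G" "3 \<le> card \<sigma>" using IH1 step.hyps(2) by blast+
  show ?case
  proof (cases "sb gt \<sigma> = {}")
    case True
    have d: "(\<alpha>, \<alpha> - sb gt \<alpha>) \<in> A \<or> (\<exists>\<rho>. (\<rho>, \<alpha>) \<in> A)"
      if "\<alpha> \<subseteq> G" "3 \<le> card \<alpha>" "\<alpha> \<notin> \<Omega> - {\<sigma>, \<sigma> - sb gt \<sigma>}" "sb gt \<alpha> \<noteq> {}" for \<alpha>
    proof -
      have "\<alpha> \<notin> \<Omega>" using that True by auto
      then show ?thesis using IH3 that by blast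
    qed
    let ?\<Omega> = "\<Omega> - {\<sigma>, \<sigma> - sb gt \<sigma>}"
    have a: "?\<Omega> \<subseteq> {\<sigma>. \<sigma> \<subseteq> G \<and> 3 \<le> card \<sigma>}" using IH1 by blast
    have b: "\<alpha> \<subseteq> G \<and> 3 \<le> card \<alpha> \<and> sb gt \<alpha> \<noteq> {} \<and> \<tau> = \<alpha> - sb gt \<alpha> \<and> \<alpha> \<notin> ?\<Omega> \<and> \<tau> \<notin> ?\<Omega> \<and>
       (\<forall>\<rho>\<in>?\<Omega>. card \<rho> \<le> card \<alpha>) \<and> (\<forall>\<rho>. (\<rho>, \<alpha>) \<notin> A)" if "(\<alpha>, \<tau>) \<in> A" for \<alpha> \<tau>
      using IH2[OF that] by blast
    show ?thesis
      unfolding if_P[OF True]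
    proof (rule conjI[OF a conjI], goal_cases)
      case 1
      show ?case by (intro allI impI) (erule b)
    next
      case 2
      show ?case by (intro allI impI, elim conjE) (rule d)
    qed
  next
    case False
    have c: "card \<sigma> = Suc (card (\<sigma> - sb gt \<sigma>))"
      by (rule card_minus_sb[OF step.prems(2) fin[OF \<sigma>(1)] False])
    have 1: "(\<sigma>, \<tau>) \<notin> A" "(\<rho>, \<sigma>) \<notin> A" for \<rho> \<tau> using IH2 step.hyps(2) by blast+
    have 2: "(\<sigma> - sb gt \<sigma>, \<tau>) \<notin> A" for \<tau>
    proof
      assume "(\<sigma> - sb gt \<sigma>, \<tau>) \<in> A"
      then have "card \<sigma> \<le> card (\<sigma> - sb gt \<sigma>)" using IH2 step.hyps(2) by blast
      then show False using c by simp
    qed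
    have 3: "\<sigma> - sb gt \<sigma> \<noteq> \<sigma>" using c by auto
    have a: "\<Omega> - {\<sigma>, \<sigma> - sb gt \<sigma>} \<subseteq> {\<sigma>. \<sigma> \<subseteq> G \<and> 3 \<le> card \<sigma>}" using IH1 by blast
    let ?A = "insert (\<sigma>, \<sigma> - sb gt \<sigma>) A" and ?\<Omega> = "\<Omega> - {\<sigma>, \<sigma> - sb gt \<sigma>}"
    have b: "\<alpha> \<subseteq> G \<and> 3 \<le> card \<alpha> \<and> sb gt \<alpha> \<noteq> {} \<and> \<tau> = \<alpha> - sb gt \<alpha> \<and> \<alpha> \<notin> ?\<Omega> \<and> \<tau> \<notin> ?\<Omega> \<and>
       (\<forall>\<rho>\<in>?\<Omega>. card \<rho> \<le> card \<alpha>) \<and> (\<forall>\<rho>. (\<rho>, \<alpha>) \<notin> ?A)" if "(\<alpha>, \<tau>) \<in> ?A" for \<alpha> \<tau>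
    proof (cases "(\<alpha>, \<tau>) \<in> A")
      case True
      then have "\<alpha> \<noteq> \<sigma> - sb gt \<sigma>" using 2 by blast
      then show ?thesis using IH2[OF True] 1 by blast
    next
      case new: False
      then have "\<alpha> = \<sigma>" "\<tau> = \<sigma> - sb gt \<sigma>" using that by auto
      then show ?thesis using \<sigma> False 1 3 step.hyps(3) by auto
    qed
    have d: "(\<alpha>, \<alpha> - sb gt \<alpha>) \<in> ?A \<or> (\<exists>\<rho>. (\<rho>, \<alpha>) \<in> ?A)"
      if "\<alpha> \<subseteq> G" "3 \<le> card \<alpha>" "\<alpha> \<notin> ?\<Omega>" "sb gt \<alpha> \<noteq> {}" for \<alpha>
    proof (cases "\<alpha> \<in> \<Omega>")
      case False
      then show ?thesis using IH3 that by blast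
    next
      case True
      then have "\<alpha> = \<sigma> \<or> \<alpha> = \<sigma> - sb gt \<sigma>" using that(3) by blast
      then show ?thesis by blast
    qed
    show ?thesis unfolding if_not_P[OF False]
    proof (rule conjI[OF a conjI], goal_cases)
      case 1
      show ?case by (intro allI impI) (erule b)
    next
      case 2
      show ?case by (intro allI impI, elim conjE) (rule d)
    qed
  qed
qed

lemma bm_state_final_iff:
  assumes "bm_state G gt {} A" "finite G" "strict_linear_order_on G gt"
  shows "(\<sigma>, \<tau>) \<in> A \<longleftrightarrow> \<sigma> \<subseteq> G \<and> 3 \<le> card \<sigma> \<and> sb gt \<sigma> \<noteq> {} \<and> \<tau> = \<sigma> - sb gt \<sigma> \<and> (\<forall>\<rho>. (\<rho>, \<sigma>) \<notin> A)"
  using bm_state_inv[OF assms] by blast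

lemma bm_state_final_unique:
  assumes "bm_state G gt {} A" "bm_state G gt {} B" "finite G" "strict_linear_order_on G gt"
  shows "A = B"
proof -
  note A = bm_state_final_iff[OF assms(1,3,4)] and B = bm_state_final_iff[OF assms(2,3,4)]
  have "(\<sigma>, \<tau>) \<in> A \<longleftrightarrow> (\<sigma>, \<tau>) \<in> B" for \<sigma> \<tau>
  proof (induction "card G - card \<sigma>" arbitrary: \<sigma> \<tau> rule: less_induct)
    case less
    have "(\<rho>, \<sigma>) \<in> A \<longleftrightarrow> (\<rho>, \<sigma>) \<in> B" for \<rho>
    proof (cases "\<rho> \<subseteq> G \<and> sb gt \<rho> \<noteq> {} \<and> \<sigma> = \<rho> - sb gt \<rho>")
      case True
      then have "card \<rho> = Suc (card \<sigma>)"
        using card_minus_sb[OF assms(4)] assms(3) finite_subset by blast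
      moreover have "card \<rho> \<le> card G" using True assms(3) by (simp add: card_mono)
      ultimately have "card G - card \<rho> < card G - card \<sigma>" by simp
      then show ?thesis by (rule less)
    next
      case False
      then show ?thesis using A[of \<rho> \<sigma>] B[of \<rho> \<sigma>] by blast
    qed
    then show ?case using A[of \<sigma> \<tau>] B[of \<sigma> \<tau>] by simp
  qed
  then show ?thesis by auto
qed

lemma bm_state_terminates:
  assumes "bm_state G gt \<Omega> A" "finite \<Omega>"
  shows "\<exists>B. bm_state G gt {} B"
  using assms
proof (induction "card \<Omega>" arbitrary: \<Omega> A rule: less_induct)
  case less
  show ?case
  proof (cases "\<Omega> = {}")
    case False
    obtain \<sigma> where \<sigma>: "\<sigma> \<in> \<Omega>" "\<forall>\<tau>\<in>\<Omega>. card \<tau> \<le> card \<sigma>"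
      using obtains_MAX[OF less.prems(2) False, of card] less.prems(2) by (metis Max_ge finite_imageI imageI)
    have "card (\<Omega> - {\<sigma>, \<sigma> - sb gt \<sigma>}) < card \<Omega>"
      using \<sigma>(1) less.prems(2) by (intro psubset_card_mono) auto
    then show ?thesis
      using less.hyps bm_state.step[OF less.prems(1) \<sigma>] less.prems(2) by blast
  qed (use less.prems in blast)
qed

theorem bm_state_final_ex1:
  assumes "finite G" "strict_linear_order_on G gt"
  shows "\<exists>!A. bm_state G gt {} A"
proof -
  have "finite {\<sigma>. \<sigma> \<subseteq> G \<and> 3 \<le> card \<sigma>}" using assms(1) by simp
  then show ?thesis
    using bm_state_terminates[OF bm_state.start] bm_state_final_unique assms by blast
qed

end

theory Submission
  imports Defs
begin

text \<open>In general a differential of a Morse resolution can contain units, because two critical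
  subsets with the same least common multiple may be joined by a gradient path. Bridge-friendliness
  rules this out for a simple reason. The loop of the Barile-Macchia algorithm visits every subset
  with a bridge and makes it the source or the target of an edge. If no edge is discarded
  afterwards, then every subset with a bridge is matched, so a critical subset \<open>\<sigma>\<close> has no bridge
  (\<open>bridgeless_if_critical\<close>). Removing any element from such a \<open>\<sigma>\<close> strictly decreases the least
  common multiple. Along a gradient path the least common multiple never increases again: ordinary
  edges pass to a subset, and the reversed edges are \<open>lcm\<close>-homogeneous
  (\<open>lcm_decreases_along_gradient_path\<close>). Therefore every monomial \<open>lcm \<sigma> / lcm \<tau>\<close> occurring in the
  differential of \<open>\<sigma>\<close> is different from 1 and lies in the ideal generated by the variables.

  The loop only considers subsets with at least three elements. Smaller subsets have no
  bridges anyway, since the minimal generators form an antichain and \<open>1\<close> is not among them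
  (\<open>card_ge_3_if_bridge\<close>).\<close>

section \<open>Least common multiples and bridges\<close>

lemma lookup_lcm_mon_mono:
  assumes "finite \<sigma>" "\<tau> \<subseteq> \<sigma>"
  shows "Poly_Mapping.lookup (lcm_mon \<tau>) x \<le> Poly_Mapping.lookup (lcm_mon \<sigma>) x"
  unfolding lookup_lcm_mon using assms by (intro Max_mono) auto

lemma lcm_mon_empty [simp]: "lcm_mon {} = 0"
  by (rule poly_mapping_eqI) (simp add: lookup_lcm_mon)

lemma lcm_mon_singleton [simp]: "lcm_mon {m} = m"
  by (rule poly_mapping_eqI) (simp add: lookup_lcm_mon)

lemma sb_nonempty_if_bridge:
  assumes "strict_linear_order_on G gt" "finite G" "\<sigma> \<subseteq> G" "bridge \<sigma> m"
  shows "sb gt \<sigma> \<noteq> {}"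
proof -
  let ?B = "{m. bridge \<sigma> m}"
  have B: "?B \<subseteq> G" using assms(3) by (auto simp: bridge_def)
  have "finite ?B" using B assms(2) by (rule finite_subset)
  have "wf (gt\<inverse> \<inter> ?B \<times> ?B)"
  proof (rule finite_acyclic_wf)
    show "finite (gt\<inverse> \<inter> ?B \<times> ?B)" using \<open>finite ?B\<close> by simp
    have "trans (gt\<inverse>)" "irrefl (gt\<inverse>)"
      using assms(1) by (simp_all add: strict_linear_order_on_def irrefl_def)
    then have "acyclic (gt\<inverse>)" by (simp add: acyclic_irrefl)
    then show "acyclic (gt\<inverse> \<inter> ?B \<times> ?B)" by (rule acyclic_subset) blast
  qed
  then obtain b where b: "b \<in> ?B" "\<And>y. (y, b) \<in> gt\<inverse> \<inter> ?B \<times> ?B \<Longrightarrow> y \<notin> ?B"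
    using assms(4) by (metis mem_Collect_eq wfE_min)
  have "(m', b) \<in> gt" if m': "bridge \<sigma> m'" "m' \<noteq> b" for m'
  proof -
    have "total_on G gt" using assms(1) by (simp add: strict_linear_order_on_def)
    then have "(m', b) \<in> gt \<or> (b, m') \<in> gt"
      using m' b(1) B by (auto simp: total_on_def)
    then show ?thesis using b m'(1) by auto
  qed
  then have "b \<in> sb gt \<sigma>" using b(1) by (simp add: sb_def)
  then show ?thesis by blast
qed

lemma lcm_mon_remove_sb:
  assumes "strict_linear_order_on G gt"
  shows "lcm_mon (\<sigma> - sb gt \<sigma>) = lcm_mon \<sigma>"
  using assms
proof (cases rule: sb_cases[where \<sigma> = \<sigma>])
  case (2 m)
  then have "bridge \<sigma> m" by (auto simp: sb_def)
  then show ?thesis using 2 by (simp add: bridge_def)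
qed simp

lemma one_notin_mingens:
  assumes "monomial_ideal (I :: ('x::finite, 'k::field) mpoly set)" "I \<noteq> UNIV"
  shows "0 \<notin> mingens I"
proof
  assume "0 \<in> mingens I"
  then have "(monom 0 :: ('x, 'k) mpoly) \<in> I" by (simp add: mingens_def)
  then have one: "1 \<in> I" by (simp add: monom_def)
  obtain S where I: "I = module.span (*) (monom ` S)"
    using assms(1) by (auto simp: monomial_ideal_def ideal_gen_def)
  have "p \<in> I" for p
    using ideal_span_scale[of 1 _ p] one unfolding I by simp
  then show False using assms(2) by blast
qed

text \<open>A bridge of a subset with one or two elements would be the generator \<open>1\<close> or would divide
  another generator.\<close>

lemma card_ge_3_if_bridge:
  fixes I :: "('x::finite, 'k::field) mpoly set"
  assumes "monomial_ideal I" "I \<noteq> UNIV" "\<sigma> \<subseteq> mingens I" "bridge \<sigma> m"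
  shows "3 \<le> card \<sigma>"
proof (rule ccontr)
  assume "\<not> 3 \<le> card \<sigma>"
  have fin: "finite \<sigma>" using assms(3) finite_mingens by (rule finite_subset)
  have m: "m \<in> \<sigma>" and eq: "lcm_mon (\<sigma> - {m}) = lcm_mon \<sigma>"
    using assms(4) by (simp_all add: bridge_def)
  have "card (\<sigma> - {m}) \<le> 1" using \<open>\<not> 3 \<le> card \<sigma>\<close> m by simp
  then consider "\<sigma> - {m} = {}" | g where "\<sigma> - {m} = {g}"
    using fin by (metis One_nat_def card_0_eq card_1_singletonE finite_Diff le_Suc_eq le_zero_eq)
  then show False
  proof cases
    case 1
    then have "\<sigma> = {m}" using m by blast
    then have "m = 0" using eq by simp
    then show False using one_notin_mingens[OF assms(1,2)] m assms(3) by blast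
  next
    case 2
    then have g: "g \<in> \<sigma>" "g \<noteq> m" by auto
    have "Poly_Mapping.lookup m x \<le> Poly_Mapping.lookup g x" for x
      using lookup_lcm_mon_mono[OF fin, of "{m}" x] m eq 2 by simp
    then have "g = m + (g - m)"
      by (intro poly_mapping_eqI) (simp add: lookup_add lookup_minus)
    then have "m = g" using m g assms(3) by (blast intro: mingens_antichain)
    then show False using g by simp
  qed
qed

section \<open>The Barile-Macchia matching\<close>

lemma bm_loop_edges_iff:
  assumes "finite G" "strict_linear_order_on G gt"
  shows "(\<sigma>, \<tau>) \<in> bm_loop_edges G gt \<longleftrightarrow> \<sigma> \<subseteq> G \<and> 3 \<le> card \<sigma> \<and> sb gt \<sigma> \<noteq> {} \<and>
    \<tau> = \<sigma> - sb gt \<sigma> \<and> (\<forall>\<rho>. (\<rho>, \<sigma>) \<notin> bm_loop_edges G gt)"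
proof -
  have "bm_state G gt {} (bm_loop_edges G gt)"
    unfolding bm_loop_edges_def by (rule theI'[OF bm_state_final_ex1[OF assms]])
  then show ?thesis by (rule bm_state_final_iff[OF _ assms])
qed

lemma bm_matching_eq_loop_edges:
  assumes "strict_linear_order_on (mingens I) gt" "bridge_friendly I gt"
  shows "bm_matching (mingens I) gt = bm_loop_edges (mingens I) gt"
proof
  show "bm_matching (mingens I) gt \<subseteq> bm_loop_edges (mingens I) gt"
    by (auto simp: bm_matching_def)
  show "bm_loop_edges (mingens I) gt \<subseteq> bm_matching (mingens I) gt"
  proof clarify
    fix \<sigma> \<tau> assume e: "(\<sigma>, \<tau>) \<in> bm_loop_edges (mingens I) gt"
    then have "\<sigma> \<subseteq> mingens I" "\<tau> = \<sigma> - sb gt \<sigma>"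
      using bm_loop_edges_iff[OF finite_mingens assms(1)] by blast+
    then show "(\<sigma>, \<tau>) \<in> bm_matching (mingens I) gt"
      using e assms(2) by (auto simp: bridge_friendly_def potentially_type2_def type2_def)
  qed
qed

text \<open>A subset with a bridge that is not the target of a loop edge is the source of one, and for a
  bridge-friendly ideal all loop edges belong to the matching.\<close>

lemma bridgeless_if_critical:
  fixes I :: "('x::finite, 'k::field) mpoly set"
  assumes "monomial_ideal I" "I \<noteq> UNIV" "strict_linear_order_on (mingens I) gt"
    and "bridge_friendly I gt" "\<sigma> \<in> critical (mingens I) (bm_matching (mingens I) gt)"
  shows "\<not> bridge \<sigma> m"
proof
  assume m: "bridge \<sigma> m"
  have \<sigma>: "\<sigma> \<subseteq> mingens I"
    and unmatched: "(\<sigma>, \<tau>) \<notin> bm_loop_edges (mingens I) gt"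
      "(\<tau>, \<sigma>) \<notin> bm_loop_edges (mingens I) gt" for \<tau>
    using assms(5) unfolding bm_matching_eq_loop_edges[OF assms(3,4)]
    by (auto simp: critical_def)
  have "3 \<le> card \<sigma>" by (rule card_ge_3_if_bridge[OF assms(1,2) \<sigma> m])
  moreover have "sb gt \<sigma> \<noteq> {}"
    by (rule sb_nonempty_if_bridge[OF assms(3) finite_mingens \<sigma> m])
  ultimately have "(\<sigma>, \<sigma> - sb gt \<sigma>) \<in> bm_loop_edges (mingens I) gt"
    using bm_loop_edges_iff[OF finite_mingens assms(3)] \<sigma> unmatched(2) by blast
  then show False using unmatched(1) by blast
qed

lemma bm_matching_lcm_homogeneous:
  assumes "finite G" "strict_linear_order_on G gt" "(\<sigma>, \<tau>) \<in> bm_matching G gt"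
  shows "lcm_mon \<sigma> = lcm_mon \<tau>"
proof -
  have "(\<sigma>, \<tau>) \<in> bm_loop_edges G gt" using assms(3) by (auto simp: bm_matching_def)
  then have "\<tau> = \<sigma> - sb gt \<sigma>" using bm_loop_edges_iff[OF assms(1,2)] by blast
  then show ?thesis using lcm_mon_remove_sb[OF assms(2)] by simp
qed

section \<open>Gradient paths\<close>

lemma successively_last_le_hd:
  fixes f :: "'a \<Rightarrow> 'b::preorder"
  assumes "successively R xs" "xs \<noteq> []" "\<And>a b. R a b \<Longrightarrow> f b \<le> f a"
  shows "f (last xs) \<le> f (hd xs)"
  using assms(1,2)
proof (induction xs rule: induct_list012)
  case (3 a b xs)
  then have "f (last (b # xs)) \<le> f b" by simp
  also have "f b \<le> f a" using 3 assms(3) by simp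
  finally show ?case by simp
qed simp_all

lemma lcm_decreases_along_gradient_path:
  assumes "finite G" "\<And>\<rho> \<rho>'. (\<rho>, \<rho>') \<in> A \<Longrightarrow> lcm_mon \<rho> = lcm_mon \<rho>'"
    and "P \<in> gradient_paths G A \<sigma> \<tau>"
  shows "Poly_Mapping.lookup (lcm_mon \<tau>) x \<le> Poly_Mapping.lookup (lcm_mon \<sigma>) x"
proof -
  have P: "successively (\<lambda>\<rho> \<rho>'. (\<rho>, \<rho>') \<in> reversed_edges G A) P"
    "P \<noteq> []" "hd P = \<sigma>" "last P = \<tau>"
    using assms(3) by (simp_all add: gradient_paths_def)
  have "Poly_Mapping.lookup (lcm_mon \<rho>') x \<le> Poly_Mapping.lookup (lcm_mon \<rho>) x"
    if e: "(\<rho>, \<rho>') \<in> reversed_edges G A" for \<rho> \<rho>'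
  proof (cases "(\<rho>', \<rho>) \<in> A")
    case True
    then show ?thesis using assms(2) by simp
  next
    case False
    then have "\<rho> \<subseteq> G" "\<rho>' \<subseteq> \<rho>"
      using e by (auto simp: reversed_edges_def subset_edges_def)
    then show ?thesis using assms(1) finite_subset lookup_lcm_mon_mono by blast
  qed
  then show ?thesis
    using successively_last_le_hd[OF P(1,2), of "\<lambda>\<rho>. Poly_Mapping.lookup (lcm_mon \<rho>) x"] P(3,4)
    by simp
qed

text \<open>The exponent of the monomial \<open>lcm \<sigma> / lcm \<tau>\<close> is a truncated difference, so it vanishes as
  soon as \<open>lcm \<sigma>\<close> divides \<open>lcm \<tau>\<close>. Since \<open>lcm \<tau>\<close> divides \<open>lcm \<sigma>'\<close>, the element missing from
  \<open>\<sigma>'\<close> would then be a bridge of \<open>\<sigma>\<close>.\<close>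

lemma lcm_quotient_nonzero_if_bridgeless:
  assumes "finite G" "\<And>\<rho> \<rho>'. (\<rho>, \<rho>') \<in> A \<Longrightarrow> lcm_mon \<rho> = lcm_mon \<rho>'"
    and "\<sigma> \<subseteq> G" "\<And>m. \<not> bridge \<sigma> m"
    and "\<sigma>' \<subseteq> \<sigma>" "Suc (card \<sigma>') = card \<sigma>" "P \<in> gradient_paths G A \<sigma>' \<tau>"
  shows "lcm_mon \<sigma> - lcm_mon \<tau> \<noteq> 0"
proof
  assume "lcm_mon \<sigma> - lcm_mon \<tau> = 0"
  then have le: "Poly_Mapping.lookup (lcm_mon \<sigma>) x \<le> Poly_Mapping.lookup (lcm_mon \<tau>) x" for x
    by (metis diff_is_0_eq lookup_minus lookup_zero)
  have fin: "finite \<sigma>" using assms(3,1) by (rule finite_subset)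
  have "card (\<sigma> - \<sigma>') = 1"
    using assms(5,6) fin by (simp add: card_Diff_subset finite_subset flip: assms(6))
  then obtain m where "\<sigma> - \<sigma>' = {m}" by (rule card_1_singletonE)
  then have m: "m \<in> \<sigma>" "\<sigma>' = \<sigma> - {m}" using assms(5) by auto
  have "lcm_mon \<sigma>' = lcm_mon \<sigma>"
  proof (rule poly_mapping_eqI)
    fix x
    show "Poly_Mapping.lookup (lcm_mon \<sigma>') x = Poly_Mapping.lookup (lcm_mon \<sigma>) x"
      using lookup_lcm_mon_mono[OF fin assms(5), of x] le[of x]
        lcm_decreases_along_gradient_path[OF assms(1,2,7), of x] by simp
  qed
  then have "bridge \<sigma> m" using m by (simp add: bridge_def)
  then show False using assms(4) by blast
qed

section \<open>Minimality\<close>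

lemma monom_in_max_ideal:
  assumes "m \<noteq> 0"
  shows "(monom m :: ('x, 'k::field) mpoly) \<in> max_ideal"
proof -
  obtain x where x: "Poly_Mapping.lookup m x \<noteq> 0"
    using assms by (metis lookup_zero poly_mapping_eqI)
  let ?v = "Poly_Mapping.single x 1 :: 'x mon"
  have "m = (m - ?v) + ?v"
    using x by (intro poly_mapping_eqI)
      (auto simp: lookup_add lookup_minus lookup_single when_def)
  then have "(monom m :: ('x, 'k) mpoly) = monom (m - ?v) * monom ?v" by (metis monom_mult)
  then show ?thesis
    unfolding max_ideal_def ideal_gen_def by (metis ideal_span_base ideal_span_scale rangeI)
qed

lemma single_in_ideal_times:
  assumes "a \<in> \<aa>" "b \<in> B"
  shows "Poly_Mapping.single b (c * a) \<in> ideal_times \<aa> (free_module B)"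
proof -
  have "Poly_Mapping.single b (c * a) = smult a (Poly_Mapping.single b c)"
    by (rule poly_mapping_eqI) (simp add: lookup_single when_def mult.commute)
  moreover have "Poly_Mapping.single b c \<in> free_module B"
    using assms(2) by (simp add: free_module_def)
  ultimately show ?thesis
    unfolding ideal_times_def using assms(1)
    by (auto intro!: module.span_base[OF module_smult])
qed

lemma smult_in_ideal_times:
  "f \<in> ideal_times \<aa> F \<Longrightarrow> smult a f \<in> ideal_times \<aa> F"
  unfolding ideal_times_def by (rule module.span_scale[OF module_smult])

lemma sum_in_ideal_times:
  "(\<And>i. i \<in> S \<Longrightarrow> f i \<in> ideal_times \<aa> F) \<Longrightarrow> sum f S \<in> ideal_times \<aa> F"
  unfolding ideal_times_def by (rule module.span_sum[OF module_smult])

text \<open>The differential of a critical \<open>\<sigma>\<close> is a sum of terms \<open>c \<cdot> (lcm \<sigma> / lcm \<tau>) \<tau>\<close>, one for each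
  gradient path from a facet of \<open>\<sigma>\<close> to \<open>\<tau>\<close>. As \<open>\<sigma>\<close> has no bridge, each of these monomials is
  different from 1, so the terms lie in the required submodule one by one, without any
  cancellation between paths.\<close>

lemma morse_complex_minimal_if_critical_bridgeless:
  assumes "finite G" "\<And>\<rho> \<rho>'. (\<rho>, \<rho>') \<in> A \<Longrightarrow> lcm_mon \<rho> = lcm_mon \<rho>'"
    and bridgeless: "\<And>\<sigma> m. \<sigma> \<in> critical G A \<Longrightarrow> \<not> bridge \<sigma> m"
  shows "minimal_complex
    (morse_module G A :: nat \<Rightarrow> ('x::finite mon set \<Rightarrow>\<^sub>0 ('x, 'k::field) mpoly) set)
    (\<lambda>r. morse_diff G gt A)"
  unfolding minimal_complex_def
proof (intro allI impI image_subsetI)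
  fix r and f :: "'x mon set \<Rightarrow>\<^sub>0 ('x, 'k) mpoly"
  assume f: "f \<in> morse_module G A r"
  let ?M = "ideal_times max_ideal (morse_module G A (r - 1))
    :: ('x mon set \<Rightarrow>\<^sub>0 ('x, 'k) mpoly) set"
  have "morse_diff_basis G gt A \<sigma> \<in> ?M" if "\<sigma> \<in> Poly_Mapping.keys f" for \<sigma>
  proof -
    have \<sigma>: "\<sigma> \<in> critical G A" "card \<sigma> = r"
      using f that by (auto simp: morse_module_def free_module_def)
    have "Poly_Mapping.single \<tau> (of_int (path_weight gt A P) * monom (lcm_mon \<sigma> - lcm_mon \<tau>)) \<in> ?M"
      if "\<sigma>' \<subseteq> \<sigma>" "Suc (card \<sigma>') = card \<sigma>" "\<tau> \<in> critical G A" "Suc (card \<tau>) = card \<sigma>"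
        "P \<in> gradient_paths G A \<sigma>' \<tau>" for \<sigma>' \<tau> P
      unfolding morse_module_def
    proof (intro single_in_ideal_times monom_in_max_ideal)
      have "\<sigma> \<subseteq> G" using \<sigma>(1) by (simp add: critical_def)
      then show "lcm_mon \<sigma> - lcm_mon \<tau> \<noteq> 0"
        using lcm_quotient_nonzero_if_bridgeless[OF assms(1,2)] bridgeless[OF \<sigma>(1)] that(1,2,5)
        by blast
      show "\<tau> \<in> {\<tau> \<in> critical G A. card \<tau> = r - 1}" using that(3,4) \<sigma>(2) by auto
    qed
    then show ?thesis
      unfolding morse_diff_basis_def
      by (intro sum_in_ideal_times smult_in_ideal_times) auto
  qed
  then show "morse_diff G gt A f \<in> ?M"
    unfolding morse_diff_def by (intro sum_in_ideal_times smult_in_ideal_times)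
qed

theorem theorem2p29:
  fixes I :: "('x::finite, 'k::field) mpoly set"
    and gt :: "('x mon \<times> 'x mon) set"
  assumes "monomial_ideal I"
    and "I \<noteq> UNIV"
    and "strict_linear_order_on (mingens I) gt"
    and "bridge_friendly I gt"
  shows "minimal_complex (barile_macchia_module I gt) (barile_macchia_diff I gt)"
proof -
  have "minimal_complex (morse_module (mingens I) (bm_matching (mingens I) gt)
      :: nat \<Rightarrow> ('x mon set \<Rightarrow>\<^sub>0 ('x, 'k) mpoly) set)
    (\<lambda>r. morse_diff (mingens I) gt (bm_matching (mingens I) gt))"
    using bm_matching_lcm_homogeneous[OF finite_mingens assms(3)] bridgeless_if_critical[OF assms]
    by (intro morse_complex_minimal_if_critical_bridgeless finite_mingens) blast+
  moreover have "(barile_macchia_module I gt :: nat \<Rightarrow> ('x mon set \<Rightarrow>\<^sub>0 ('x, 'k) mpoly) set) =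
      morse_module (mingens I) (bm_matching (mingens I) gt)"
    by (simp add: fun_eq_iff barile_macchia_module_def)
  moreover have "(barile_macchia_diff I gt :: nat \<Rightarrow> ('x mon set \<Rightarrow>\<^sub>0 ('x, 'k) mpoly) \<Rightarrow> _) =
      (\<lambda>r. morse_diff (mingens I) gt (bm_matching (mingens I) gt))"
    by (simp add: fun_eq_iff barile_macchia_diff_def)
  ultimately show ?thesis by simp
qed

end
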